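(* Let $(A,\mu)$ be an associative algebra, $r\in A^{\otimes 2}$ be a solution of the associative Yang-Baxter equation (AYBE) in $A$, and $\alpha\colon A\to A$ be an algebra morphism. Then $(\alpha^{\otimes 2})^n(r)$ is a solution of the associative Hom-Yang-Baxter equation (AHYBE) in the Hom-associative algebra $A_\alpha=(A,\mu_\alpha=\alpha\circ\mu,\alpha)$ for each integer $n\ge 0$.
   Context: Throughout, $\mathbf{k}$ is a fixed field of characteristic $0$; vector spaces, linear maps and tensor products are over $\mathbf{k}$. Algebras are not required to be unital; an algebra morphism is a linear map commuting with the multiplications. For a linear self-map $f$, $f^n$ denotes its $n$-fold composition, with $f^0=Id$. A Hom-associative algebra $(A,\mu,\alpha)$ is a $\mathbf{k}$-vector space $A$ with a bilinear map $\mu\colon A^{\otimes 2}\to A$ and a linear map $\alpha\colon A\to A$ such that $\alpha\circ\mu=\mu\circ\alpha^{\otimes 2}$ and $\mu\circ(\alpha\otimes\mu)=\mu\circ(\mu\otimes\alpha)$. In a Hom-associative algebra $(A,\mu,\alpha)$, for $r=\sum u_i\otimes v_i\in A^{\otimes 2}$ set $$A(r)=\sum_{i,j}\mu(u_i,u_j)\otimes\alpha(v_j)\otimes\alpha(v_i)-\sum_{i,j}\alpha(u_i)\otimes\mu(v_i,u_j)\otimes\alpha(v_j)+\sum_{i,j}\alpha(u_j)\otimes\alpha(u_i)\otimes\mu(v_i,v_j)\in A^{\otimes 3}.$$ The element $r$ is a solution of the AHYBE in $A$ if $A(r)=0$. When $\alpha=Id$ (so $(A,\mu)$ is an associative algebra),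 the AHYBE is called the AYBE. *)

theory Defs
  imports Complex_Main "HOL-Library.Poly_Mapping"
begin

section \<open>Algebras\<close>

locale algebra_over = vector_space scale
  for scale :: "'k::field \<Rightarrow> 'a::ab_group_add \<Rightarrow> 'a" +
  fixes mult :: "'a \<Rightarrow> 'a \<Rightarrow> 'a"
  assumes linear_mult_right: "Vector_Spaces.linear scale scale (\<lambda>y. mult x y)"
    and linear_mult_left: "Vector_Spaces.linear scale scale (\<lambda>x. mult x y)"

locale associative_algebra = algebra_over scale mult
  for scale :: "'k::field \<Rightarrow> 'a::ab_group_add \<Rightarrow> 'a" and mult +
  assumes mult_assoc: "mult x (mult y z) = mult (mult x y) z"

locale hom_associative_algebra = algebra_over scale mult
  for scale :: "'k::field \<Rightarrow> 'a::ab_group_add \<Rightarrow> 'a" and mult +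
  fixes \<alpha> :: "'a \<Rightarrow> 'a"
  assumes linear_twist: "Vector_Spaces.linear scale scale \<alpha>"
    and twist_mult: "\<alpha> (mult x y) = mult (\<alpha> x) (\<alpha> y)"
    and hom_assoc: "mult (\<alpha> x) (mult y z) = mult (mult x y) (\<alpha> z)"

definition algebra_endomorphism ::
    "('k::field \<Rightarrow> 'a::ab_group_add \<Rightarrow> 'a) \<Rightarrow> ('a \<Rightarrow> 'a \<Rightarrow> 'a) \<Rightarrow> ('a \<Rightarrow> 'a) \<Rightarrow> bool" where
  "algebra_endomorphism scale mult f \<longleftrightarrow>
     Vector_Spaces.linear scale scale f \<and> (\<forall>x y. f (mult x y) = mult (f x) (f y))"


section \<open>Tensor powers\<close>

text \<open>
  The free vector space on a type \<open>'i\<close> is \<open>'i \<Rightarrow>\<^sub>0 'k\<close>, with basis vectors \<open>gen x\<close>.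
  The tensor powers \<open>A \<otimes> A\<close> and \<open>A \<otimes> A \<otimes> A\<close> are the quotients of the free vector spaces on
  \<open>A \<times> A\<close> and \<open>A \<times> A \<times> A\<close> by the subspace spanned by the bilinearity and trilinearity relations.
  The relations depend on the scalar multiplication of \<open>A\<close>, so the quotients are
  sets of equivalence classes and not types.
\<close>

definition free_scale :: "'k::field \<Rightarrow> ('i \<Rightarrow>\<^sub>0 'k) \<Rightarrow> ('i \<Rightarrow>\<^sub>0 'k)" where
  "free_scale c p = Poly_Mapping.map ((*) c) p"

abbreviation gen :: "'i \<Rightarrow> ('i \<Rightarrow>\<^sub>0 'k::field)" where
  "gen x \<equiv> Poly_Mapping.single x 1"

lemma lookup_free_scale: "poly_mapping.lookup (free_scale c p) x = c * poly_mapping.lookup p x"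
  by (simp add: free_scale_def Poly_Mapping.map.rep_eq Poly_Mapping.when_def)

interpretation free: vector_space "free_scale :: 'k::field \<Rightarrow> ('i \<Rightarrow>\<^sub>0 'k) \<Rightarrow> ('i \<Rightarrow>\<^sub>0 'k)"
  by unfold_locales
    (auto intro!: poly_mapping_eqI simp: lookup_free_scale Poly_Mapping.lookup_add algebra_simps)

definition bilinear_relations ::
    "('k::field \<Rightarrow> 'a::ab_group_add \<Rightarrow> 'a) \<Rightarrow> ('a \<times> 'a \<Rightarrow>\<^sub>0 'k) set" where
  "bilinear_relations scale =
     {gen (x + x', y) - gen (x, y) - gen (x', y) | x x' y. True} \<union>
     {gen (x, y + y') - gen (x, y) - gen (x, y') | x y y'. True} \<union>
     {gen (scale c x, y) - free_scale c (gen (x, y)) | c x y. True} \<union>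
     {gen (x, scale c y) - free_scale c (gen (x, y)) | c x y. True}"

definition trilinear_relations ::
    "('k::field \<Rightarrow> 'a::ab_group_add \<Rightarrow> 'a) \<Rightarrow> ('a \<times> 'a \<times> 'a \<Rightarrow>\<^sub>0 'k) set" where
  "trilinear_relations scale =
     {gen (x + x', y, z) - gen (x, y, z) - gen (x', y, z) | x x' y z. True} \<union>
     {gen (x, y + y', z) - gen (x, y, z) - gen (x, y', z) | x y y' z. True} \<union>
     {gen (x, y, z + z') - gen (x, y, z) - gen (x, y, z') | x y z z'. True} \<union>
     {gen (scale c x, y, z) - free_scale c (gen (x, y, z)) | c x y z. True} \<union>
     {gen (x, scale c y, z) - free_scale c (gen (x, y, z)) | c x y z. True} \<union>
     {gen (x, y, scale c z) - free_scale c (gen (x, y, z)) | c x y z. True}"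

definition cong_modulo :: "('i \<Rightarrow>\<^sub>0 'k::field) set \<Rightarrow> (('i \<Rightarrow>\<^sub>0 'k) \<times> ('i \<Rightarrow>\<^sub>0 'k)) set" where
  "cong_modulo R = {(p, q). p - q \<in> free.span R}"

definition tensor_square ::
    "('k::field \<Rightarrow> 'a::ab_group_add \<Rightarrow> 'a) \<Rightarrow> ('a \<times> 'a \<Rightarrow>\<^sub>0 'k) set set" where
  "tensor_square scale = UNIV // cong_modulo (bilinear_relations scale)"

abbreviation class2 ::
    "('k::field \<Rightarrow> 'a::ab_group_add \<Rightarrow> 'a) \<Rightarrow> ('a \<times> 'a \<Rightarrow>\<^sub>0 'k) \<Rightarrow> ('a \<times> 'a \<Rightarrow>\<^sub>0 'k) set" where
  "class2 scale p \<equiv> cong_modulo (bilinear_relations scale) `` {p}"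

abbreviation class3 ::
    "('k::field \<Rightarrow> 'a::ab_group_add \<Rightarrow> 'a) \<Rightarrow> ('a \<times> 'a \<times> 'a \<Rightarrow>\<^sub>0 'k) \<Rightarrow>
     ('a \<times> 'a \<times> 'a \<Rightarrow>\<^sub>0 'k) set" where
  "class3 scale p \<equiv> cong_modulo (trilinear_relations scale) `` {p}"

text \<open>The element \<open>\<Sum> u\<^sub>i \<otimes> v\<^sub>i\<close> of \<open>A \<otimes> A\<close>, for a finite family \<open>ps\<close> of pairs \<open>(u\<^sub>i, v\<^sub>i)\<close>:\<close>

definition tensor_sum ::
    "('k::field \<Rightarrow> 'a::ab_group_add \<Rightarrow> 'a) \<Rightarrow> ('a \<times> 'a) list \<Rightarrow> ('a \<times> 'a \<Rightarrow>\<^sub>0 'k) set" where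
  "tensor_sum scale ps = class2 scale (\<Sum>(u, v)\<leftarrow>ps. gen (u, v))"

text \<open>
  The next two operations on \<open>r \<in> A \<otimes> A\<close> are given in terms of an expansion
  \<open>r = \<Sum> u\<^sub>i \<otimes> v\<^sub>i\<close>. The union collects the results over all expansions; these results are
  one and the same class, see \<open>tensor_map_tensor_sum\<close> and \<open>hyb_tensor_tensor_sum\<close> below, and
  every \<open>r\<close> has an expansion, see \<open>tensor_square_expansion\<close>.
\<close>

definition tensor_map ::
    "('k::field \<Rightarrow> 'a::ab_group_add \<Rightarrow> 'a) \<Rightarrow> ('a \<Rightarrow> 'a) \<Rightarrow>
     ('a \<times> 'a \<Rightarrow>\<^sub>0 'k) set \<Rightarrow> ('a \<times> 'a \<Rightarrow>\<^sub>0 'k) set" where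
  "tensor_map scale f r =
     (\<Union>ps \<in> {ps. r = tensor_sum scale ps}. class2 scale (\<Sum>(u, v)\<leftarrow>ps. gen (f u, f v)))"


section \<open>The associative (Hom-)Yang-Baxter equation\<close>

definition hyb_sum ::
    "('a \<Rightarrow> 'a \<Rightarrow> 'a) \<Rightarrow> ('a \<Rightarrow> 'a) \<Rightarrow> ('a \<times> 'a) list \<Rightarrow> ('a \<times> 'a \<times> 'a \<Rightarrow>\<^sub>0 'k::field)" where
  "hyb_sum mult \<alpha> ps =
     (\<Sum>(ui, vi)\<leftarrow>ps. \<Sum>(uj, vj)\<leftarrow>ps. gen (mult ui uj, \<alpha> vj, \<alpha> vi))
   - (\<Sum>(ui, vi)\<leftarrow>ps. \<Sum>(uj, vj)\<leftarrow>ps. gen (\<alpha> ui, mult vi uj, \<alpha> vj))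
   + (\<Sum>(ui, vi)\<leftarrow>ps. \<Sum>(uj, vj)\<leftarrow>ps. gen (\<alpha> uj, \<alpha> ui, mult vi vj))"

text \<open>The element \<open>A(r)\<close> of \<open>A \<otimes> A \<otimes> A\<close>:\<close>

definition hyb_tensor ::
    "('k::field \<Rightarrow> 'a::ab_group_add \<Rightarrow> 'a) \<Rightarrow> ('a \<Rightarrow> 'a \<Rightarrow> 'a) \<Rightarrow> ('a \<Rightarrow> 'a) \<Rightarrow>
     ('a \<times> 'a \<Rightarrow>\<^sub>0 'k) set \<Rightarrow> ('a \<times> 'a \<times> 'a \<Rightarrow>\<^sub>0 'k) set" where
  "hyb_tensor scale mult \<alpha> r =
     (\<Union>ps \<in> {ps. r = tensor_sum scale ps}. class3 scale (hyb_sum mult \<alpha> ps))"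

definition ahybe_solution ::
    "('k::field \<Rightarrow> 'a::ab_group_add \<Rightarrow> 'a) \<Rightarrow> ('a \<Rightarrow> 'a \<Rightarrow> 'a) \<Rightarrow> ('a \<Rightarrow> 'a) \<Rightarrow>
     ('a \<times> 'a \<Rightarrow>\<^sub>0 'k) set \<Rightarrow> bool" where
  "ahybe_solution scale mult \<alpha> r \<longleftrightarrow>
     r \<in> tensor_square scale \<and> hyb_tensor scale mult \<alpha> r = class3 scale 0"

definition aybe_solution ::
    "('k::field \<Rightarrow> 'a::ab_group_add \<Rightarrow> 'a) \<Rightarrow> ('a \<Rightarrow> 'a \<Rightarrow> 'a) \<Rightarrow>
     ('a \<times> 'a \<Rightarrow>\<^sub>0 'k) set \<Rightarrow> bool" where
  "aybe_solution scale mult r \<longleftrightarrow> ahybe_solution scale mult id r"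


section \<open>Well-definedness\<close>

lemma equiv_cong_modulo: "equiv UNIV (cong_modulo R)"
proof (rule equivI)
  show "refl (cong_modulo R)"
    by (auto simp: refl_on_def cong_modulo_def free.span_zero)
  show "sym (cong_modulo R)"
    by (auto simp: sym_def cong_modulo_def dest: free.span_neg)
  show "trans (cong_modulo R)"
  proof (rule transI)
    fix p q s assume "(p, q) \<in> cong_modulo R" "(q, s) \<in> cong_modulo R"
    then have "(p - q) + (q - s) \<in> free.span R"
      unfolding cong_modulo_def by (blast intro: free.span_add)
    then show "(p, s) \<in> cong_modulo R" by (simp add: cong_modulo_def)
  qed
qed auto

lemma class_eq_iff:
  "cong_modulo R `` {p} = cong_modulo R `` {q} \<longleftrightarrow> p - q \<in> free.span R"
  by (subst eq_equiv_class_iff[OF equiv_cong_modulo]) (auto simp: cong_modulo_def)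

lemma Union_const_on:
  assumes "P a" "\<And>b. P b \<Longrightarrow> f b = f a"
  shows "(\<Union>b\<in>{b. P b}. f b) = f a"
  using assms by blast

lemma tensor_sum_altdef: "tensor_sum scale ps = class2 scale (\<Sum>x\<leftarrow>ps. gen x)"
  by (simp add: tensor_sum_def case_prod_unfold)

text \<open>The linear extension of a map on basis vectors:\<close>

definition free_extend :: "('i \<Rightarrow> ('j \<Rightarrow>\<^sub>0 'k::field)) \<Rightarrow> ('i \<Rightarrow>\<^sub>0 'k) \<Rightarrow> ('j \<Rightarrow>\<^sub>0 'k)" where
  "free_extend g p = (\<Sum>x\<in>Poly_Mapping.keys p. free_scale (poly_mapping.lookup p x) (g x))"

lemma free_extend_superset:
  assumes "finite S" "Poly_Mapping.keys p \<subseteq> S"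
  shows "free_extend g p = (\<Sum>x\<in>S. free_scale (poly_mapping.lookup p x) (g x))"
  unfolding free_extend_def
  by (rule sum.mono_neutral_left) (use assms in \<open>auto simp: in_keys_iff\<close>)

lemma free_extend_gen [simp]: "free_extend g (gen x) = g x"
  by (simp add: free_extend_def)

lemma linear_free_extend:
  fixes g :: "'i \<Rightarrow> ('j \<Rightarrow>\<^sub>0 'k::field)"
  shows "Vector_Spaces.linear free_scale free_scale (free_extend g)"
proof unfold_locales
  fix p q :: "'i \<Rightarrow>\<^sub>0 'k"
  let ?S = "Poly_Mapping.keys p \<union> Poly_Mapping.keys q"
  have "free_extend g (p + q) = (\<Sum>x\<in>?S. free_scale (poly_mapping.lookup (p + q) x) (g x))"
    by (intro free_extend_superset Poly_Mapping.keys_add) auto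
  also have "\<dots> = free_extend g p + free_extend g q"
    by (simp add: Poly_Mapping.lookup_add free.scale_left_distrib sum.distrib
        free_extend_superset[of ?S])
  finally show "free_extend g (p + q) = free_extend g p + free_extend g q" .
next
  fix c p
  have "free_extend g (free_scale c p) =
      (\<Sum>x\<in>Poly_Mapping.keys p. free_scale (poly_mapping.lookup (free_scale c p) x) (g x))"
    by (intro free_extend_superset) (auto simp: in_keys_iff lookup_free_scale)
  then show "free_extend g (free_scale c p) = free_scale c (free_extend g p)"
    by (simp add: free_extend_def lookup_free_scale free.scale_sum_right)
qed

lemmas free_extend_add = module_hom.add[OF linear_free_extend[unfolded linear_iff_module_hom]]
  and free_extend_scale = module_hom.scale[OF linear_free_extend[unfolded linear_iff_module_hom]]
  and free_extend_diff = module_hom.diff[OF linear_free_extend[unfolded linear_iff_module_hom]]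
  and free_extend_zero = module_hom.zero[OF linear_free_extend[unfolded linear_iff_module_hom]]

lemma free_extend_sum_list: "free_extend g (\<Sum>x\<leftarrow>ps. gen x) = (\<Sum>x\<leftarrow>ps. g x)"
  by (induction ps) (simp_all add: free_extend_add free_extend_zero)

lemma free_extend_span:
  assumes "\<And>b. b \<in> R \<Longrightarrow> free_extend g b \<in> free.span R'" "p \<in> free.span R"
  shows "free_extend g p \<in> free.span R'"
  using assms(2)
  by (induction rule: free.span_induct_alt)
    (simp_all add: free_extend_zero free_extend_add free_extend_scale
      free.span_zero free.span_add free.span_scale assms(1))

text \<open>Linearity modulo a set of relations:\<close>

definition linear_modulo ::
    "('k::field \<Rightarrow> 'a::ab_group_add \<Rightarrow> 'a) \<Rightarrow> ('i \<Rightarrow>\<^sub>0 'k) set \<Rightarrow> ('a \<Rightarrow> ('i \<Rightarrow>\<^sub>0 'k)) \<Rightarrow> bool" where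
  "linear_modulo scale R g \<longleftrightarrow>
     (\<forall>x y. g (x + y) - g x - g y \<in> free.span R) \<and>
     (\<forall>c x. g (scale c x) - free_scale c (g x) \<in> free.span R)"

lemma linear_modulo_add:
  assumes "linear_modulo scale R g" "linear_modulo scale R h"
  shows "linear_modulo scale R (\<lambda>x. g x + h x)"
  unfolding linear_modulo_def
proof (intro conjI allI)
  fix x y
  have "(g (x + y) - g x - g y) + (h (x + y) - h x - h y) \<in> free.span R"
    using assms by (intro free.span_add) (auto simp: linear_modulo_def)
  then show "g (x + y) + h (x + y) - (g x + h x) - (g y + h y) \<in> free.span R"
    by (simp add: algebra_simps)
next
  fix c x
  have "(g (scale c x) - free_scale c (g x)) + (h (scale c x) - free_scale c (h x)) \<in> free.span R"
    using assms by (intro free.span_add) (auto simp: linear_modulo_def)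
  then show "g (scale c x) + h (scale c x) - free_scale c (g x + h x) \<in> free.span R"
    by (simp add: algebra_simps)
qed

lemma linear_modulo_uminus:
  assumes "linear_modulo scale R g"
  shows "linear_modulo scale R (\<lambda>x. - g x)"
  unfolding linear_modulo_def
proof (intro conjI allI)
  fix x y
  have "- (g (x + y) - g x - g y) \<in> free.span R"
    using assms by (intro free.span_neg) (auto simp: linear_modulo_def)
  then show "- g (x + y) - - g x - - g y \<in> free.span R"
    by (simp add: algebra_simps)
next
  fix c x
  have "- (g (scale c x) - free_scale c (g x)) \<in> free.span R"
    using assms by (intro free.span_neg) (auto simp: linear_modulo_def)
  then show "- g (scale c x) - free_scale c (- g x) \<in> free.span R"
    by (simp add: algebra_simps)
qed

lemma linear_modulo_diff:
  assumes "linear_modulo scale R g" "linear_modulo scale R h"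
  shows "linear_modulo scale R (\<lambda>x. g x - h x)"
  using linear_modulo_add[OF assms(1) linear_modulo_uminus[OF assms(2)]] by simp

lemma linear_modulo_gen2:
  assumes "Vector_Spaces.linear scale scale f"
  shows "linear_modulo scale (bilinear_relations scale) (\<lambda>x. gen (f x, b))"
    and "linear_modulo scale (bilinear_relations scale) (\<lambda>x. gen (a, f x))"
proof -
  interpret module_hom scale scale f using assms by (simp add: linear_iff_module_hom)
  show "linear_modulo scale (bilinear_relations scale) (\<lambda>x. gen (f x, b))"
    and "linear_modulo scale (bilinear_relations scale) (\<lambda>x. gen (a, f x))"
    unfolding linear_modulo_def add scale
    by (intro conjI allI free.span_base; unfold bilinear_relations_def; blast)+
qed

lemma linear_modulo_gen3:
  assumes "Vector_Spaces.linear scale scale f"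
  shows "linear_modulo scale (trilinear_relations scale) (\<lambda>x. gen (f x, b, c))"
    and "linear_modulo scale (trilinear_relations scale) (\<lambda>x. gen (a, f x, c))"
    and "linear_modulo scale (trilinear_relations scale) (\<lambda>x. gen (a, b, f x))"
proof -
  interpret module_hom scale scale f using assms by (simp add: linear_iff_module_hom)
  show "linear_modulo scale (trilinear_relations scale) (\<lambda>x. gen (f x, b, c))"
    and "linear_modulo scale (trilinear_relations scale) (\<lambda>x. gen (a, f x, c))"
    and "linear_modulo scale (trilinear_relations scale) (\<lambda>x. gen (a, b, f x))"
    unfolding linear_modulo_def add scale
    by (intro conjI allI free.span_base; unfold trilinear_relations_def;
        (((rule UnI2, rule CollectI, (rule exI)+, rule conjI[OF refl TrueI]) | rule UnI1)+)?;
        (rule CollectI, (rule exI)+, rule conjI[OF refl TrueI])?)+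
qed

lemma free_extend_bilinear:
  assumes "\<And>v. linear_modulo scale R (\<lambda>u. g (u, v))"
    and "\<And>u. linear_modulo scale R (\<lambda>v. g (u, v))"
    and "p \<in> free.span (bilinear_relations scale)"
  shows "free_extend g p \<in> free.span R"
proof (rule free_extend_span[OF _ assms(3)])
  fix b assume "b \<in> bilinear_relations scale"
  with assms(1,2) show "free_extend g b \<in> free.span R"
    unfolding bilinear_relations_def linear_modulo_def
    by (auto simp: free_extend_diff free_extend_scale)
qed

lemma tensor_map_tensor_sum:
  assumes "Vector_Spaces.linear scale scale f"
  shows "tensor_map scale f (tensor_sum scale ps) = tensor_sum scale (map (map_prod f f) ps)"
proof -
  let ?g = "\<lambda>(u, v). gen (f u, f v)"
  have "class2 scale (\<Sum>x\<leftarrow>qs. ?g x) = class2 scale (\<Sum>x\<leftarrow>ps. ?g x)"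
    if "tensor_sum scale ps = tensor_sum scale qs" for qs
  proof -
    have "(\<Sum>x\<leftarrow>qs. gen x) - (\<Sum>x\<leftarrow>ps. gen x) \<in> free.span (bilinear_relations scale)"
      using that by (simp only: tensor_sum_altdef class_eq_iff[symmetric])
    then have "free_extend ?g ((\<Sum>x\<leftarrow>qs. gen x) - (\<Sum>x\<leftarrow>ps. gen x))
        \<in> free.span (bilinear_relations scale)"
      by (rule free_extend_bilinear[rotated 2])
        (simp_all add: linear_modulo_gen2[OF assms])
    then show ?thesis
      by (simp add: class_eq_iff free_extend_diff free_extend_sum_list)
  qed
  then have "tensor_map scale f (tensor_sum scale ps) = class2 scale (\<Sum>x\<leftarrow>ps. ?g x)"
    unfolding tensor_map_def by - (rule Union_const_on, rule refl, blast)
  then show ?thesis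
    by (simp add: tensor_sum_def comp_def case_prod_unfold map_prod_def)
qed

lemma hyb_sum_altdef:
  "hyb_sum mult \<alpha> ps = (\<Sum>(ui, vi)\<leftarrow>ps. \<Sum>(uj, vj)\<leftarrow>ps. gen (mult ui uj, \<alpha> vj, \<alpha> vi)
     - gen (\<alpha> ui, mult vi uj, \<alpha> vj) + gen (\<alpha> uj, \<alpha> ui, mult vi vj))"
  by (simp add: hyb_sum_def case_prod_unfold sum_list_addf sum_list_subtractf)

lemma hyb_tensor_tensor_sum:
  fixes scale :: "'k::field \<Rightarrow> 'a::ab_group_add \<Rightarrow> 'a"
  assumes "algebra_over scale mult" and \<alpha>: "Vector_Spaces.linear scale scale \<alpha>"
  shows "hyb_tensor scale mult \<alpha> (tensor_sum scale ps) = class3 scale (hyb_sum mult \<alpha> ps)"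
proof -
  interpret algebra_over scale mult by fact
  let ?R = "trilinear_relations scale"
  define T :: "'a \<times> 'a \<Rightarrow> 'a \<times> 'a \<Rightarrow> ('a \<times> 'a \<times> 'a \<Rightarrow>\<^sub>0 'k)" where
    "T x y = gen (mult (fst x) (fst y), \<alpha> (snd y), \<alpha> (snd x))
      - gen (\<alpha> (fst x), mult (snd x) (fst y), \<alpha> (snd y))
      + gen (\<alpha> (fst y), \<alpha> (fst x), mult (snd x) (snd y))" for x y
  have T: "hyb_sum mult \<alpha> qs = (\<Sum>x\<leftarrow>qs. \<Sum>y\<leftarrow>qs. T x y)" for qs
    by (simp add: hyb_sum_altdef T_def case_prod_unfold)
  note lin = linear_modulo_add linear_modulo_diff linear_modulo_gen3
    \<alpha> linear_mult_left linear_mult_right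
  have T_right: "free_extend (T x) p \<in> free.span ?R"
    if "p \<in> free.span (bilinear_relations scale)" for x p
    by (rule free_extend_bilinear[OF _ _ that]) (auto simp: T_def intro!: lin)
  have T_left: "free_extend (\<lambda>x. T x y) p \<in> free.span ?R"
    if "p \<in> free.span (bilinear_relations scale)" for y p
    by (rule free_extend_bilinear[OF _ _ that]) (auto simp: T_def intro!: lin)
  have span_sum_list: "(\<Sum>x\<leftarrow>xs. h x) \<in> free.span ?R"
    if "\<And>x. h x \<in> free.span ?R" for h and xs :: "('a \<times> 'a) list"
    using that by (induction xs) (auto intro: free.span_zero free.span_add)
  have "class3 scale (hyb_sum mult \<alpha> qs) = class3 scale (hyb_sum mult \<alpha> ps)"
    if "tensor_sum scale ps = tensor_sum scale qs" for qs
  proof -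
    let ?d = "(\<Sum>x\<leftarrow>qs. gen x) - (\<Sum>x\<leftarrow>ps. gen x)"
    have d: "?d \<in> free.span (bilinear_relations scale)"
      using that by (simp only: tensor_sum_altdef class_eq_iff[symmetric])
    have "(\<Sum>x\<leftarrow>qs. free_extend (T x) ?d) + (\<Sum>y\<leftarrow>ps. free_extend (\<lambda>x. T x y) ?d)
        \<in> free.span ?R"
      by (intro free.span_add span_sum_list T_right T_left d)
    also have "(\<Sum>x\<leftarrow>qs. free_extend (T x) ?d) + (\<Sum>y\<leftarrow>ps. free_extend (\<lambda>x. T x y) ?d) =
        (\<Sum>x\<leftarrow>qs. \<Sum>y\<leftarrow>qs. T x y) - (\<Sum>x\<leftarrow>qs. \<Sum>y\<leftarrow>ps. T x y)
        + ((\<Sum>y\<leftarrow>ps. \<Sum>x\<leftarrow>qs. T x y) - (\<Sum>y\<leftarrow>ps. \<Sum>x\<leftarrow>ps. T x y))"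
      by (simp add: free_extend_diff free_extend_sum_list sum_list_subtractf)
    also have "(\<Sum>y\<leftarrow>ps. \<Sum>x\<leftarrow>qs. T x y) = (\<Sum>x\<leftarrow>qs. \<Sum>y\<leftarrow>ps. T x y)"
      by (induction ps) (simp_all add: sum_list_addf)
    also have "(\<Sum>y\<leftarrow>ps. \<Sum>x\<leftarrow>ps. T x y) = (\<Sum>x\<leftarrow>ps. \<Sum>y\<leftarrow>ps. T x y)"
    proof -
      have "(\<Sum>y\<leftarrow>as. \<Sum>x\<leftarrow>bs. T x y) = (\<Sum>x\<leftarrow>bs. \<Sum>y\<leftarrow>as. T x y)" for as bs
        by (induction as) (simp_all add: sum_list_addf)
      then show ?thesis .
    qed
    finally show ?thesis
      by (simp add: class_eq_iff T)
  qed
  then show ?thesis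
    unfolding hyb_tensor_def by - (rule Union_const_on, rule refl, blast)
qed

lemma tensor_square_expansion:
  assumes "vector_space scale" "r \<in> tensor_square scale"
  shows "\<exists>ps. r = tensor_sum scale ps"
proof -
  interpret vector_space scale by fact
  let ?R = "bilinear_relations scale"
  have gen_scale: "gen (scale c x, y) - free_scale c (gen (x, y)) \<in> free.span ?R" for c x y
    by (rule free.span_base) (auto simp: bilinear_relations_def)
  have *: "\<exists>ps. p - (\<Sum>x\<leftarrow>ps. gen x) \<in> free.span ?R" for p
  proof -
    have "p \<in> free.span (range gen)"
    proof -
      have "p = (\<Sum>x\<in>Poly_Mapping.keys p. free_scale (poly_mapping.lookup p x) (gen x))"
      proof (rule poly_mapping_eqI)
        fix k
        show "poly_mapping.lookup p k =
            poly_mapping.lookup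
              (\<Sum>x\<in>Poly_Mapping.keys p. free_scale (poly_mapping.lookup p x) (gen x)) k"
          by (simp add: Poly_Mapping.lookup_sum lookup_free_scale Poly_Mapping.lookup_single
              when_def in_keys_iff
              if_distrib sum.delta cong: if_cong)
      qed
      also have "\<dots> \<in> free.span (range gen)"
        by (intro free.span_sum free.span_scale free.span_base) auto
      finally show ?thesis .
    qed
    then show ?thesis
    proof (induction rule: free.span_induct_alt)
      case base
      show ?case by (rule exI[of _ "[]"]) (simp add: free.span_zero)
    next
      case (step c b q)
      obtain x y where b: "b = gen (x, y)" using step by auto
      obtain ps where ps: "q - (\<Sum>x\<leftarrow>ps. gen x) \<in> free.span ?R" using step by blast
      have "(q - (\<Sum>x\<leftarrow>ps. gen x)) - (gen (scale c x, y) - free_scale c (gen (x, y))) \<in> free.span ?R"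
        by (intro free.span_diff ps gen_scale)
      then show ?case
        by (intro exI[of _ "(scale c x, y) # ps"]) (simp add: b algebra_simps)
    qed
  qed
  obtain p where r: "r = class2 scale p"
    using assms(2) by (auto simp: tensor_square_def elim: quotientE)
  with * show ?thesis
    by (auto simp only: tensor_sum_altdef class_eq_iff)
qed

end

(* The n-th iterate of an algebra endomorphism f is again one, so (f \<otimes> f)^n replaces an
   expansion of r by its image under f^n.  Each term of A(r) for the twisted algebra then has
   all three tensor factors in the image of f^(n+1), because the twisted product supplies the
   missing f where the other two factors have the twisting map.  Hence A((f \<otimes> f)^n r) is the
   image under the third tensor power of f^(n+1) of the element A(r) for the untwisted algebra,
   which vanishes. *)
theory Submission
  imports Defs
begin

lemma tensor_sum_in_tensor_square: "tensor_sum scale ps \<in> tensor_square scale"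
  unfolding tensor_sum_def tensor_square_def by (intro quotientI UNIV_I)

lemma linear_funpow:
  assumes "Vector_Spaces.linear scale scale f"
  shows "Vector_Spaces.linear scale scale (f ^^ n)"
proof (induction n)
  case 0
  \<comment> \<open>Linearity of \<open>f\<close> carries the vector space structure that linearity
    of the identity requires.\<close>
  from assms interpret Vector_Spaces.linear scale scale f .
  show ?case using vs1.linear_id by (simp add: id_def)
next
  case (Suc n)
  then show ?case using Vector_Spaces.linear_compose[OF _ assms] by (simp add: comp_def)
qed

lemma algebra_endomorphism_funpow:
  assumes "algebra_endomorphism scale mult f"
  shows "algebra_endomorphism scale mult (f ^^ n)"
proof -
  have "(f ^^ n) (mult x y) = mult ((f ^^ n) x) ((f ^^ n) y)" for x y
    using assms by (induction n) (simp_all add: algebra_endomorphism_def)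
  with assms show ?thesis
    by (simp add: algebra_endomorphism_def linear_funpow)
qed

text \<open>Since \<open>f\<close> is multiplicative, the two sides of Hom-associativity are
  \<open>f (f (mult x (mult y z)))\<close> and \<open>f (f (mult (mult x y) z))\<close>, so
  associativity of \<open>mult\<close> suffices.\<close>

lemma hom_associative_algebra_twist:
  assumes "associative_algebra scale mult" and "algebra_endomorphism scale mult f"
  shows "hom_associative_algebra scale (\<lambda>x y. f (mult x y)) f"
proof -
  interpret associative_algebra scale mult by fact
  have lin: "Vector_Spaces.linear scale scale f"
    and hom: "\<And>x y. f (mult x y) = mult (f x) (f y)"
    using assms(2) by (auto simp: algebra_endomorphism_def)
  show ?thesis
  proof (intro hom_associative_algebra.intro algebra_over.intro algebra_over_axioms.intro
      hom_associative_algebra_axioms.intro vector_space_axioms)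
    show "Vector_Spaces.linear scale scale (\<lambda>y. f (mult x y))" for x
      using Vector_Spaces.linear_compose[OF linear_mult_right lin] by (simp add: comp_def)
    show "Vector_Spaces.linear scale scale (\<lambda>x. f (mult x y))" for y
      using Vector_Spaces.linear_compose[OF linear_mult_left lin] by (simp add: comp_def)
  qed (simp_all add: lin hom mult_assoc)
qed

lemma funpow_tensor_map_tensor_sum:
  assumes "Vector_Spaces.linear scale scale f"
  shows "(tensor_map scale f ^^ n) (tensor_sum scale ps) =
    tensor_sum scale (map (map_prod (f ^^ n) (f ^^ n)) ps)"
  by (induction n)
    (simp_all add: tensor_map_tensor_sum[OF assms] comp_def map_prod_def case_prod_unfold)

text \<open>Each family of trilinear relations varies a single slot, and linearity modulo
  \<open>R\<close> in that slot sends it into the span. This is how maps descend to the third tensor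
  power.\<close>

lemma free_extend_trilinear:
  assumes "\<And>y z. linear_modulo scale R (\<lambda>x. g (x, y, z))"
    and "\<And>x z. linear_modulo scale R (\<lambda>y. g (x, y, z))"
    and "\<And>x y. linear_modulo scale R (\<lambda>z. g (x, y, z))"
    and "p \<in> free.span (trilinear_relations scale)"
  shows "free_extend g p \<in> free.span R"
proof (rule free_extend_span[OF _ assms(4)])
  fix b assume "b \<in> trilinear_relations scale"
  with assms(1-3) show "free_extend g b \<in> free.span R"
    unfolding trilinear_relations_def linear_modulo_def
    by (auto simp: free_extend_diff free_extend_scale)
qed

text \<open>The third tensor power of \<open>f\<close>, acting on representatives in the free vector
  space; \<open>tensor_cube_map_span\<close> lets it pass to classes.\<close>

definition tensor_cube_map ::
    "('a \<Rightarrow> 'a) \<Rightarrow> ('a \<times> 'a \<times> 'a \<Rightarrow>\<^sub>0 'k::field) \<Rightarrow> ('a \<times> 'a \<times> 'a \<Rightarrow>\<^sub>0 'k)" where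
  "tensor_cube_map f = free_extend (\<lambda>(x, y, z). gen (f x, f y, f z))"

lemma tensor_cube_map_span:
  assumes "Vector_Spaces.linear scale scale f"
    and "p \<in> free.span (trilinear_relations scale)"
  shows "tensor_cube_map f p \<in> free.span (trilinear_relations scale)"
  unfolding tensor_cube_map_def
  by (rule free_extend_trilinear[OF _ _ _ assms(2)])
    (simp_all add: linear_modulo_gen3[OF assms(1)])

lemma tensor_cube_map_sum_list:
  "tensor_cube_map f (\<Sum>x\<leftarrow>xs. h x) = (\<Sum>x\<leftarrow>xs. tensor_cube_map f (h x))"
  by (induction xs) (simp_all add: tensor_cube_map_def free_extend_zero free_extend_add)

text \<open>Holds exactly in the free vector space, summand by summand: a factor
  \<open>f (mult (g x) (g y))\<close> equals \<open>f (g (mult x y))\<close>, and every other factor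
  is already \<open>f (g x)\<close>.\<close>

lemma hyb_sum_twist:
  assumes "\<And>x y. g (mult x y) = mult (g x) (g y)"
  shows "hyb_sum (\<lambda>x y. f (mult x y)) f (map (map_prod g g) ps) =
    tensor_cube_map (f \<circ> g) (hyb_sum mult id ps)"
proof -
  have diff_add: "tensor_cube_map (f \<circ> g) (p - q + s) = tensor_cube_map (f \<circ> g) p
      - tensor_cube_map (f \<circ> g) q + tensor_cube_map (f \<circ> g) s" for p q s
    by (simp add: tensor_cube_map_def free_extend_add free_extend_diff)
  have gen: "tensor_cube_map (f \<circ> g) (gen (x, y, z)) = gen (f (g x), f (g y), f (g z))" for x y z
    by (simp add: tensor_cube_map_def)
  show ?thesis
    \<comment> \<open>The instance of \<open>comp_def\<close> unfolds only compositions with the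
      mapped list; \<open>f \<circ> g\<close> stays folded so that \<open>diff_add\<close> and
      \<open>gen\<close> match.\<close>
    by (simp add: hyb_sum_altdef case_prod_unfold tensor_cube_map_sum_list diff_add gen assms
        comp_def[of _ "map_prod g g"])
qed

theorem theorem5p2:
  fixes scale :: "'k::field_char_0 \<Rightarrow> 'a::ab_group_add \<Rightarrow> 'a"
    and \<mu> :: "'a \<Rightarrow> 'a \<Rightarrow> 'a"
    and \<alpha> :: "'a \<Rightarrow> 'a"
    and r :: "('a \<times> 'a \<Rightarrow>\<^sub>0 'k) set"
    and n :: nat
  assumes "associative_algebra scale \<mu>"
    and "r \<in> tensor_square scale"
    and "aybe_solution scale \<mu> r"
    and "algebra_endomorphism scale \<mu> \<alpha>"
  shows "hom_associative_algebra scale (\<lambda>x y. \<alpha> (\<mu> x y)) \<alpha> \<and>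
    ahybe_solution scale (\<lambda>x y. \<alpha> (\<mu> x y)) \<alpha> ((tensor_map scale \<alpha> ^^ n) r)"
proof
  show twist: "hom_associative_algebra scale (\<lambda>x y. \<alpha> (\<mu> x y)) \<alpha>"
    by (rule hom_associative_algebra_twist) fact+
  interpret associative_algebra scale \<mu> by fact
  interpret twist: hom_associative_algebra scale "\<lambda>x y. \<alpha> (\<mu> x y)" \<alpha> by (rule twist)
  have pow: "algebra_endomorphism scale \<mu> (\<alpha> ^^ n)"
    by (rule algebra_endomorphism_funpow) fact
  \<comment> \<open>One expansion suffices, because both operations on tensors are independent of
    its choice.\<close>
  obtain ps where r: "r = tensor_sum scale ps"
    using tensor_square_expansion[OF vector_space_axioms assms(2)] by blast
  let ?qs = "map (map_prod (\<alpha> ^^ n) (\<alpha> ^^ n)) ps"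
  have "class3 scale (hyb_sum \<mu> id ps) = class3 scale 0"
    using assms(3) hyb_tensor_tensor_sum[OF algebra_over_axioms linear_id, of ps]
    by (simp add: aybe_solution_def ahybe_solution_def r)
  then have "hyb_sum \<mu> id ps \<in> free.span (trilinear_relations scale)"
    by (simp only: class_eq_iff diff_zero)
  then have "tensor_cube_map (\<alpha> \<circ> \<alpha> ^^ n) (hyb_sum \<mu> id ps)
      \<in> free.span (trilinear_relations scale)"
    \<comment> \<open>\<open>\<alpha> ^^ Suc n\<close> unfolds to
      \<open>\<alpha> \<circ> \<alpha> ^^ n\<close>, the form that \<open>hyb_sum_twist\<close>
      produces.\<close>
    using linear_funpow[OF twist.linear_twist, of "Suc n"]
    by (intro tensor_cube_map_span) simp_all
  then have "hyb_sum (\<lambda>x y. \<alpha> (\<mu> x y)) \<alpha> ?qs \<in> free.span (trilinear_relations scale)"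
    using pow by (subst hyb_sum_twist) (simp_all add: algebra_endomorphism_def)
  then have "class3 scale (hyb_sum (\<lambda>x y. \<alpha> (\<mu> x y)) \<alpha> ?qs) = class3 scale 0"
    by (simp only: class_eq_iff diff_zero)
  then show "ahybe_solution scale (\<lambda>x y. \<alpha> (\<mu> x y)) \<alpha> ((tensor_map scale \<alpha> ^^ n) r)"
    by (simp add: ahybe_solution_def r funpow_tensor_map_tensor_sum twist.linear_twist
        tensor_sum_in_tensor_square hyb_tensor_tensor_sum twist.algebra_over_axioms)
qed

end
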